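(* Let $L_s=-\partial^2+u_s$ be an algebro-geometric Schrödinger operator of level $s$ with spectral curve $\Gamma_s$, and let $K=C\langle u_s\rangle$. The field of constants of $K(\Gamma_s)$ is $C(\Gamma_s)$.
   Context: $(\Sigma,\partial)$ is a differential field of characteristic zero whose field of constants $C$ is algebraically closed. An operator $L\in\Sigma[\partial]\setminus C[\partial]$ of order $n$ is algebro-geometric if some $P\in\Sigma[\partial]$ of order relatively prime to $n$ satisfies $[L,P]=0$. Let $L_s=-\partial^2+u_s$ with $u_s\in\Sigma\setminus C$ be algebro-geometric. Then there is a unique monic operator $A_{2s+1}$ of minimal order $2s+1$ (minimal among operators of the centralizer not in $C[L_s]$) such that the centralizer of $L_s$ in $\Sigma[\partial]$ is $C[L_s,A_{2s+1}]$ and $A_{2s+1}^2+R_{2s+1}(L_s)=0$ with $R_{2s+1}\in C[\lambda]$ of degree $2s+1$; $A_{2s+1}$ is called the partner of $L_s$ and $s$ the level. $K=C\langle u_s\rangle$ is the differential subfield of $\Sigma$ generated by $C$ and $u_s$. Let $\lambda,\mu$ be algebraic indeterminates over $K$ with $\partial\lambda=\partial\mu=0$, so $\partial$ extends to $K[\lambda,\mu]$ coefficientwise. Put $f_s(\lambda,\mu)=\mu^2+R_{2s+1}(\lambda)$; the spectral curve $\Gamma_s\subset C^2$ is $f_s=0$. Write $(f_s)$ for the (prime) ideal generated by $f_s$ in $C[\lambda,\mu]$ or in $K[\lambda,\mu]$. $C(\Gamma_s)$ and $K(\Gamma_s)$ are the fraction fields of $C[\Gamma_s]=C[\lambda,\mu]/(f_s)$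 and $K[\Gamma_s]=K[\lambda,\mu]/(f_s)$. $K[\Gamma_s]$ has the derivation $\tilde\partial(q+(f_s))=\partial(q)+(f_s)$, extended to $K(\Gamma_s)$. *)

theory Defs
  imports
    "HOL-Algebra.Algebraic_Closure"
    "HOL-Algebra.QuotRing"
    "HOL-Algebra.Generated_Rings"
    "HOL-Computational_Algebra.Polynomial"
begin

section \<open>Differential fields\<close>

locale differential_field =
  fixes D :: "'a::field_char_0 \<Rightarrow> 'a"
  assumes deriv_add: "D (x + y) = D x + D y"
    and deriv_mult: "D (x * y) = D x * y + x * D y"

definition constants :: "('a::zero \<Rightarrow> 'a) \<Rightarrow> 'a set" where
  "constants D = {c. D c = 0}"

text \<open>A subset of a type-class ring, as a ring structure of HOL-Algebra.\<close>

definition ring_on :: "'b::comm_ring_1 set \<Rightarrow> 'b ring" where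
  "ring_on S = \<lparr>carrier = S, monoid.mult = (*), one = 1, zero = 0, add = (+)\<rparr>"

definition diff_subfield_generated :: "('a::field \<Rightarrow> 'a) \<Rightarrow> 'a set \<Rightarrow> 'a set" where
  "diff_subfield_generated D Z = \<Inter>{F. subfield F (ring_on UNIV) \<and> D ` F \<subseteq> F \<and> Z \<subseteq> F}"

definition polys_over :: "'b::zero set \<Rightarrow> 'b poly set" where
  "polys_over S = {p. set (coeffs p) \<subseteq> S}"


section \<open>Differential operators\<close>

text \<open>
  The operator with coefficients \<open>a\<^sub>i\<close>, that is, the sum of the \<open>a\<^sub>i \<partial>\<^sup>i\<close>, is encoded as the
  polynomial with the same coefficients, so that its order is the degree of the polynomial.
  Only the product differs from that of polynomials: it is determined by
  \<open>\<partial> a = a \<partial> + D a\<close>. Multiplication by \<open>\<partial>\<close> from the left is \<open>Q \<mapsto> Q \<partial> + D Q\<close>,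
  where \<open>D\<close> acts on the coefficients of \<open>Q\<close>.
\<close>

definition diff_op_mult :: "('a::comm_ring_1 \<Rightarrow> 'a) \<Rightarrow> 'a poly \<Rightarrow> 'a poly \<Rightarrow> 'a poly" where
  "diff_op_mult D P Q =
    (\<Sum>i\<le>Polynomial.degree P.
       Polynomial.smult (Polynomial.coeff P i) (((\<lambda>T. pCons 0 T + map_poly D T) ^^ i) Q))"

definition diff_ops :: "('a::comm_ring_1 \<Rightarrow> 'a) \<Rightarrow> 'a poly ring" where
  "diff_ops D = \<lparr>carrier = UNIV, monoid.mult = diff_op_mult D, one = 1, zero = 0, add = (+)\<rparr>"

definition centralizer :: "('a::comm_ring_1 \<Rightarrow> 'a) \<Rightarrow> 'a poly \<Rightarrow> 'a poly set" where
  "centralizer D L = {P. L \<otimes>\<^bsub>diff_ops D\<^esub> P = P \<otimes>\<^bsub>diff_ops D\<^esub> L}"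

text \<open>\<open>C[Z]\<close>: the subring of \<open>\<Sigma>[\<partial>]\<close> generated by the constants and a set \<open>Z\<close> of operators.\<close>

definition const_subalgebra :: "('a::comm_ring_1 \<Rightarrow> 'a) \<Rightarrow> 'a poly set \<Rightarrow> 'a poly set" where
  "const_subalgebra D Z = generate_ring (diff_ops D) ((\<lambda>c. [:c:]) ` constants D \<union> Z)"

text \<open>\<open>p(L)\<close> for a polynomial \<open>p\<close> and an operator \<open>L\<close>; \<open>smult\<close> is multiplication by a
  function from the left.\<close>

definition op_eval :: "('a::comm_ring_1 \<Rightarrow> 'a) \<Rightarrow> 'a poly \<Rightarrow> 'a poly \<Rightarrow> 'a poly" where
  "op_eval D p L =
    (\<Sum>i\<le>Polynomial.degree p. Polynomial.smult (Polynomial.coeff p i) (L [^]\<^bsub>diff_ops D\<^esub> i))"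

definition algebro_geometric :: "('a::comm_ring_1 \<Rightarrow> 'a) \<Rightarrow> 'a poly \<Rightarrow> bool" where
  "algebro_geometric D L \<longleftrightarrow>
     L \<notin> polys_over (constants D) \<and>
     (\<exists>P. P \<noteq> 0 \<and> coprime (Polynomial.degree P) (Polynomial.degree L) \<and> P \<in> centralizer D L)"

definition schroedinger :: "'a::comm_ring_1 \<Rightarrow> 'a poly" where
  "schroedinger u = [:u, 0, - 1:]"

definition is_partner ::
    "('a::comm_ring_1 \<Rightarrow> 'a) \<Rightarrow> 'a poly \<Rightarrow> nat \<Rightarrow> 'a poly \<Rightarrow> 'a poly \<Rightarrow> bool" where
  "is_partner D L s A R \<longleftrightarrow>
     A \<in> centralizer D L - const_subalgebra D {L} \<and>
     Polynomial.lead_coeff A = 1 \<and> Polynomial.degree A = 2 * s + 1 \<and>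
     (\<forall>P \<in> centralizer D L - const_subalgebra D {L}. 2 * s + 1 \<le> Polynomial.degree P) \<and>
     centralizer D L = const_subalgebra D {L, A} \<and>
     R \<in> polys_over (constants D) \<and> Polynomial.degree R = 2 * s + 1 \<and>
     A [^]\<^bsub>diff_ops D\<^esub> (2::nat) + op_eval D R L = 0"


section \<open>Fields of fractions\<close>

definition fractions :: "('b, 'm) ring_scheme \<Rightarrow> ('b \<times> 'b) set" where
  "fractions S = carrier S \<times> (carrier S - {\<zero>\<^bsub>S\<^esub>})"

definition frac_rel :: "('b, 'm) ring_scheme \<Rightarrow> (('b \<times> 'b) \<times> ('b \<times> 'b)) set" where
  "frac_rel S = {((a, b), (c, d)). (a, b) \<in> fractions S \<and> (c, d) \<in> fractions S \<and>
     a \<otimes>\<^bsub>S\<^esub> d = c \<otimes>\<^bsub>S\<^esub> b}"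

definition fraction :: "('b, 'm) ring_scheme \<Rightarrow> 'b \<Rightarrow> 'b \<Rightarrow> ('b \<times> 'b) set" where
  "fraction S a b = frac_rel S `` {(a, b)}"

text \<open>In the unions below every member contributes the same class, since the operations do not
  depend on the representatives.\<close>

definition frac_field :: "('b, 'm) ring_scheme \<Rightarrow> ('b \<times> 'b) set ring" where
  "frac_field S =
    \<lparr>carrier = fractions S // frac_rel S,
     monoid.mult = (\<lambda>Z Y. \<Union>(a, b)\<in>Z. \<Union>(c, d)\<in>Y. fraction S (a \<otimes>\<^bsub>S\<^esub> c) (b \<otimes>\<^bsub>S\<^esub> d)),
     one = fraction S \<one>\<^bsub>S\<^esub> \<one>\<^bsub>S\<^esub>,
     zero = fraction S \<zero>\<^bsub>S\<^esub> \<one>\<^bsub>S\<^esub>,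
     add = (\<lambda>Z Y. \<Union>(a, b)\<in>Z. \<Union>(c, d)\<in>Y.
              fraction S ((a \<otimes>\<^bsub>S\<^esub> d) \<oplus>\<^bsub>S\<^esub> (c \<otimes>\<^bsub>S\<^esub> b)) (b \<otimes>\<^bsub>S\<^esub> d))\<rparr>"

text \<open>The map of fraction fields induced by a map \<open>h\<close> into \<open>S\<close>, and the extension of a
  derivation \<open>d\<close> of \<open>S\<close> by the quotient rule.\<close>

definition frac_map ::
    "('c, 'm) ring_scheme \<Rightarrow> ('b \<Rightarrow> 'c) \<Rightarrow> ('b \<times> 'b) set \<Rightarrow> ('c \<times> 'c) set" where
  "frac_map S h Z = (\<Union>(a, b)\<in>Z. fraction S (h a) (h b))"

definition frac_deriv ::
    "('b, 'm) ring_scheme \<Rightarrow> ('b \<Rightarrow> 'b) \<Rightarrow> ('b \<times> 'b) set \<Rightarrow> ('b \<times> 'b) set" where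
  "frac_deriv S d Z =
     (\<Union>(a, b)\<in>Z. fraction S ((d a \<otimes>\<^bsub>S\<^esub> b) \<ominus>\<^bsub>S\<^esub> (a \<otimes>\<^bsub>S\<^esub> d b)) (b \<otimes>\<^bsub>S\<^esub> b))"

text \<open>The map of quotients induced by a map \<open>g\<close> on representatives: the coset of \<open>q\<close> goes to
  the coset \<open>J + g q\<close> in \<open>S\<close>.\<close>

definition coset_map ::
    "('c, 'm) ring_scheme \<Rightarrow> 'c set \<Rightarrow> ('b \<Rightarrow> 'c) \<Rightarrow> 'b set \<Rightarrow> 'c set" where
  "coset_map S J g Z = (\<Union>q\<in>Z. J +>\<^bsub>S\<^esub> g q)"


section \<open>Functions on the spectral curve\<close>

text \<open>Bivariate polynomials in \<open>\<lambda>\<close> and \<open>\<mu>\<close> are polynomials in \<open>\<mu>\<close> whose coefficients are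
  polynomials in \<open>\<lambda>\<close>. In what follows \<open>F\<close> is a subfield, either \<open>C\<close> or \<open>K\<close>.\<close>

definition bipoly_ring :: "'a::comm_ring_1 set \<Rightarrow> 'a poly poly ring" where
  "bipoly_ring F = ring_on (polys_over (polys_over F))"

text \<open>\<open>\<mu>\<^sup>2 + R(\<lambda>)\<close>\<close>

definition curve_poly :: "'a::comm_ring_1 poly \<Rightarrow> 'a poly poly" where
  "curve_poly R = [:R, 0, 1:]"

definition curve_ideal :: "'a::comm_ring_1 set \<Rightarrow> 'a poly \<Rightarrow> 'a poly poly set" where
  "curve_ideal F R = PIdl\<^bsub>bipoly_ring F\<^esub> curve_poly R"

definition coord_ring :: "'a::comm_ring_1 set \<Rightarrow> 'a poly \<Rightarrow> 'a poly poly set ring" where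
  "coord_ring F R = bipoly_ring F Quot curve_ideal F R"

definition function_field ::
    "'a::comm_ring_1 set \<Rightarrow> 'a poly \<Rightarrow> ('a poly poly set \<times> 'a poly poly set) set ring" where
  "function_field F R = frac_field (coord_ring F R)"

definition coord_ring_deriv ::
    "('a::comm_ring_1 \<Rightarrow> 'a) \<Rightarrow> 'a set \<Rightarrow> 'a poly \<Rightarrow> 'a poly poly set \<Rightarrow> 'a poly poly set" where
  "coord_ring_deriv D F R =
     coset_map (bipoly_ring F) (curve_ideal F R) (map_poly (map_poly D))"

definition function_field_deriv ::
    "('a::comm_ring_1 \<Rightarrow> 'a) \<Rightarrow> 'a set \<Rightarrow> 'a poly \<Rightarrow>
     ('a poly poly set \<times> 'a poly poly set) set \<Rightarrow> ('a poly poly set \<times> 'a poly poly set) set" where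
  "function_field_deriv D F R = frac_deriv (coord_ring F R) (coord_ring_deriv D F R)"

definition function_field_constants ::
    "('a::comm_ring_1 \<Rightarrow> 'a) \<Rightarrow> 'a set \<Rightarrow> 'a poly \<Rightarrow>
     ('a poly poly set \<times> 'a poly poly set) set set" where
  "function_field_constants D F R =
     {x \<in> carrier (function_field F R). function_field_deriv D F R x = \<zero>\<^bsub>function_field F R\<^esub>}"

text \<open>The map from the function field of the curve over a subfield \<open>C\<close> of \<open>F\<close> to that over \<open>F\<close>
  which is induced by the inclusion of the polynomial rings. The subfield \<open>C\<close> enters only through
  the argument, a fraction of cosets.\<close>

definition base_change ::
    "'a::comm_ring_1 set \<Rightarrow> 'a poly \<Rightarrow>
     ('a poly poly set \<times> 'a poly poly set) set \<Rightarrow> ('a poly poly set \<times> 'a poly poly set) set" where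
  "base_change F R =
     frac_map (coord_ring F R) (coset_map (bipoly_ring F) (curve_ideal F R) (\<lambda>q. q))"

end

theory Submission
  imports Defs
begin

text \<open>
  Every class in \<open>K[\<Gamma>] = K[\<lambda>,\<mu>]/(\<mu>\<^sup>2 + R)\<close> is uniquely \<open>a + b \<mu>\<close> with \<open>a, b \<in> K[\<lambda>]\<close>, and
  multiplication by the conjugate \<open>a - b \<mu>\<close> gives the norm \<open>a\<^sup>2 + R b\<^sup>2\<close>, which for a
  nonzero class is not zero because \<open>R\<close> has odd degree (\<open>norm_nonzero\<close>). Two things follow. First, \<open>\<mu>\<^sup>2 + R\<close> is prime
  (\<open>prime_curve_poly\<close>). Second, every element of \<open>K(\<Gamma>)\<close> is \<open>g + h \<mu>\<close> with \<open>g, h \<in> K(\<lambda>)\<close>. Since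
  \<open>R\<close> has constant coefficients and the derivation kills \<open>\<mu>\<close>, such an element is constant if and
  only if \<open>g\<close> and \<open>h\<close> are (\<open>constant_fraction_curve\<close>).

  It remains to see that the constants of \<open>K(\<lambda>)\<close> are \<open>C(\<lambda>)\<close> (\<open>constant_rational_function\<close>). If
  \<open>p / q\<close> is constant, in lowest terms and with \<open>q\<close> monic, and if \<open>D q \<noteq> 0\<close>, then
  \<open>p / q = D p / D q\<close>, where \<open>D q\<close> has smaller degree than \<open>q\<close>, a contradiction; so \<open>D q = 0\<close>
  and \<open>D p = 0\<close>.

  The passage from these statements on polynomials to the fraction fields of quotient rings is
  formal. Two lemmas carry it: \<open>frac_map_iso_constants\<close> for an injective map of domains and
  \<open>quotient_constants_iso\<close> for quotients by a common prime element. All divisibilities are taken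
  over the whole field \<open>\<Sigma>\<close>; this is harmless because \<open>\<mu>\<^sup>2 + R\<close> is monic in \<open>\<mu>\<close>
  (\<open>curve_poly_saturated\<close>).
\<close>

section \<open>Fractions over a domain and their constants\<close>

context domain
begin

lemma cross_multiplication_trans:
  assumes "a \<in> carrier R" "b \<in> carrier R" "c \<in> carrier R" "d \<in> carrier R"
    and "x \<in> carrier R" "y \<in> carrier R" "d \<noteq> \<zero>"
    and "a \<otimes> d = c \<otimes> b" and "c \<otimes> y = x \<otimes> d"
  shows "a \<otimes> y = x \<otimes> b"
proof -
  have "d \<otimes> (a \<otimes> y) = (a \<otimes> d) \<otimes> y"
    using assms(1-6) by (simp add: m_ac)
  also have "\<dots> = (c \<otimes> y) \<otimes> b"
    using assms(1-6) unfolding assms(8) by (simp add: m_ac)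
  also have "\<dots> = d \<otimes> (x \<otimes> b)"
    using assms(1-6) unfolding assms(9) by (simp add: m_ac)
  finally show ?thesis
    using m_lcancel[of d "a \<otimes> y" "x \<otimes> b"] assms(1-7) by simp
qed

lemma equiv_frac_rel: "equiv (fractions R) (frac_rel R)"
proof (rule equivI)
  show "frac_rel R \<subseteq> fractions R \<times> fractions R"
    by (auto simp: frac_rel_def)
  show "refl_on (fractions R) (frac_rel R)"
    by (auto simp: refl_on_def frac_rel_def)
  show "sym (frac_rel R)"
    by (auto simp: sym_def frac_rel_def)
  show "trans (frac_rel R)"
  proof (rule transI, clarify)
    fix a b c d x y
    assume "((a, b), (c, d)) \<in> frac_rel R" "((c, d), (x, y)) \<in> frac_rel R"
    then show "((a, b), (x, y)) \<in> frac_rel R"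
      using cross_multiplication_trans[of a b c d x y] by (simp add: frac_rel_def fractions_def)
  qed
qed

lemma fraction_eq_iff:
  assumes "(a, b) \<in> fractions R" "(c, d) \<in> fractions R"
  shows "fraction R a b = fraction R c d \<longleftrightarrow> a \<otimes> d = c \<otimes> b"
  using assms eq_equiv_class_iff[OF equiv_frac_rel, of "(a, b)" "(c, d)"]
  by (simp add: fraction_def frac_rel_def)

lemma mem_fraction_iff:
  assumes "(a, b) \<in> fractions R"
  shows "(c, d) \<in> fraction R a b \<longleftrightarrow> (c, d) \<in> fractions R \<and> a \<otimes> d = c \<otimes> b"
  using assms by (simp add: fraction_def frac_rel_def)

lemma fraction_in_carrier:
  assumes "(a, b) \<in> fractions R"
  shows "fraction R a b \<in> carrier (frac_field R)"
  using assms by (simp add: frac_field_def fraction_def quotientI)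

lemma frac_field_carrierE:
  assumes "x \<in> carrier (frac_field R)"
  obtains a b where "(a, b) \<in> fractions R" "x = fraction R a b"
proof -
  have "x \<in> fractions R // frac_rel R"
    using assms by (simp add: frac_field_def)
  then obtain p where "p \<in> fractions R" "x = frac_rel R `` {p}"
    by (rule quotientE)
  then show thesis
    using that[of "fst p" "snd p"] by (simp add: fraction_def)
qed

lemma fractions_mult:
  assumes "(a, b) \<in> fractions R" "(c, d) \<in> fractions R" "e \<in> carrier R"
  shows "(e, b \<otimes> d) \<in> fractions R"
  using assms by (auto simp: fractions_def integral_iff)

text \<open>
  The operations of the fraction field are unions over all representatives. Once an expression
  is known to be independent of the representative, the union is its value at any one of them.
\<close>

lemma UN_fraction:
  assumes "(a, b) \<in> fractions R"
    and "\<And>c d. \<lbrakk>(c, d) \<in> fractions R; a \<otimes> d = c \<otimes> b\<rbrakk> \<Longrightarrow> G c d = G a b"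
  shows "(\<Union>(c, d)\<in>fraction R a b. G c d) = G a b"
proof -
  have "G c d = G a b" if "(c, d) \<in> fraction R a b" for c d
    using that by (intro assms(2)) (simp_all add: mem_fraction_iff[OF assms(1)])
  moreover have "(a, b) \<in> fraction R a b"
    using assms(1) by (simp add: mem_fraction_iff)
  ultimately show ?thesis
    by (intro UN_constant_eq[of "(a, b)"]) blast+
qed

lemma UN_fraction2:
  assumes ab: "(a, b) \<in> fractions R" and ce: "(c, e) \<in> fractions R"
    and eq: "\<And>a' b' c' e'. \<lbrakk>(a', b') \<in> fractions R; a \<otimes> b' = a' \<otimes> b;
      (c', e') \<in> fractions R; c \<otimes> e' = c' \<otimes> e\<rbrakk> \<Longrightarrow> G a' b' c' e' = G a b c e"
  shows "(\<Union>(a', b')\<in>fraction R a b. \<Union>(c', e')\<in>fraction R c e. G a' b' c' e') = G a b c e"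
proof -
  have eq_G: "G a' b' c' e' = G a b c e"
    if "(a', b') \<in> fraction R a b" "(c', e') \<in> fraction R c e" for a' b' c' e'
    using that by (intro eq) (simp_all add: mem_fraction_iff[OF ab] mem_fraction_iff[OF ce])
  have "(a, b) \<in> fraction R a b" "(c, e) \<in> fraction R c e"
    using ab ce by (simp_all add: mem_fraction_iff)
  moreover have "(\<Union>(c', e')\<in>fraction R c e. G a' b' c' e') = G a b c e"
    if "(a', b') \<in> fraction R a b" for a' b'
    using eq_G[OF that] \<open>(c, e) \<in> fraction R c e\<close>
    by (intro UN_constant_eq[of "(c, e)"]) blast+
  ultimately show ?thesis
    by (intro UN_constant_eq[of "(a, b)"]) blast+
qed

lemma frac_field_mult:
  assumes "(a, b) \<in> fractions R" "(c, d) \<in> fractions R"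
  shows "fraction R a b \<otimes>\<^bsub>frac_field R\<^esub> fraction R c d = fraction R (a \<otimes> c) (b \<otimes> d)"
proof -
  have "(\<Union>(a', b')\<in>fraction R a b. \<Union>(c', d')\<in>fraction R c d. fraction R (a' \<otimes> c') (b' \<otimes> d')) =
      fraction R (a \<otimes> c) (b \<otimes> d)"
  proof (rule UN_fraction2[OF assms])
    fix a' b' c' d'
    assume f: "(a', b') \<in> fractions R" "(c', d') \<in> fractions R"
      and e: "a \<otimes> b' = a' \<otimes> b" "c \<otimes> d' = c' \<otimes> d"
    have car: "a \<in> carrier R" "b \<in> carrier R" "c \<in> carrier R" "d \<in> carrier R"
      "a' \<in> carrier R" "b' \<in> carrier R" "c' \<in> carrier R" "d' \<in> carrier R"
      using f assms by (auto simp: fractions_def)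
    have "a' \<otimes> c' \<otimes> (b \<otimes> d) = (a' \<otimes> b) \<otimes> (c' \<otimes> d)"
      using car by (simp add: m_ac)
    also have "\<dots> = a \<otimes> c \<otimes> (b' \<otimes> d')"
      unfolding e[symmetric] using car by (simp add: m_ac)
    finally show "fraction R (a' \<otimes> c') (b' \<otimes> d') = fraction R (a \<otimes> c) (b \<otimes> d)"
      using f assms car by (simp add: fraction_eq_iff fractions_mult)
  qed
  then show ?thesis
    by (simp add: frac_field_def)
qed

lemma frac_field_add:
  assumes "(a, b) \<in> fractions R" "(c, d) \<in> fractions R"
  shows "fraction R a b \<oplus>\<^bsub>frac_field R\<^esub> fraction R c d =
    fraction R ((a \<otimes> d) \<oplus> (c \<otimes> b)) (b \<otimes> d)"
proof -
  have "(\<Union>(a', b')\<in>fraction R a b. \<Union>(c', d')\<in>fraction R c d.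
      fraction R ((a' \<otimes> d') \<oplus> (c' \<otimes> b')) (b' \<otimes> d')) =
      fraction R ((a \<otimes> d) \<oplus> (c \<otimes> b)) (b \<otimes> d)"
  proof (rule UN_fraction2[OF assms])
    fix a' b' c' d'
    assume f: "(a', b') \<in> fractions R" "(c', d') \<in> fractions R"
      and e: "a \<otimes> b' = a' \<otimes> b" "c \<otimes> d' = c' \<otimes> d"
    have car: "a \<in> carrier R" "b \<in> carrier R" "c \<in> carrier R" "d \<in> carrier R"
      "a' \<in> carrier R" "b' \<in> carrier R" "c' \<in> carrier R" "d' \<in> carrier R"
      using f assms by (auto simp: fractions_def)
    have "(a' \<otimes> d' \<oplus> c' \<otimes> b') \<otimes> (b \<otimes> d) =
        (a' \<otimes> b) \<otimes> (d \<otimes> d') \<oplus> (c' \<otimes> d) \<otimes> (b \<otimes> b')"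
      using car by (simp add: m_ac l_distr r_distr)
    also have "\<dots> = (a \<otimes> d \<oplus> c \<otimes> b) \<otimes> (b' \<otimes> d')"
      unfolding e[symmetric] using car by (simp add: m_ac l_distr r_distr)
    finally show "fraction R ((a' \<otimes> d') \<oplus> (c' \<otimes> b')) (b' \<otimes> d') =
        fraction R ((a \<otimes> d) \<oplus> (c \<otimes> b)) (b \<otimes> d)"
      using f assms car by (simp add: fraction_eq_iff fractions_mult)
  qed
  then show ?thesis
    by (simp add: frac_field_def)
qed

lemma fraction_eq_zero_iff:
  assumes "(a, b) \<in> fractions R"
  shows "fraction R a b = \<zero>\<^bsub>frac_field R\<^esub> \<longleftrightarrow> a = \<zero>"
  using assms by (simp add: frac_field_def fraction_eq_iff fractions_def)

text \<open>
  The quotient rule respects cross-multiplication: applying \<open>d\<close> to \<open>a b' = a' b\<close> gives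
  \<open>d a b' + a d b' = d a' b + a' d b\<close>, and multiplying this by \<open>b b'\<close> and replacing
  \<open>a b'\<close> by \<open>a' b\<close> in the mixed terms yields the required identity.
\<close>

lemma frac_deriv_fraction:
  assumes d_closed: "\<And>x. x \<in> carrier R \<Longrightarrow> d x \<in> carrier R"
    and Leibniz: "\<And>x y. \<lbrakk>x \<in> carrier R; y \<in> carrier R\<rbrakk> \<Longrightarrow>
      d (x \<otimes> y) = d x \<otimes> y \<oplus> x \<otimes> d y"
    and ab: "(a, b) \<in> fractions R"
  shows "frac_deriv R d (fraction R a b) =
    fraction R ((d a \<otimes> b) \<ominus> (a \<otimes> d b)) (b \<otimes> b)"
  unfolding frac_deriv_def
proof (rule UN_fraction[OF ab])
  fix a' b'
  assume a'b': "(a', b') \<in> fractions R" and e: "a \<otimes> b' = a' \<otimes> b"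
  have car: "a \<in> carrier R" "b \<in> carrier R" "a' \<in> carrier R" "b' \<in> carrier R"
      "d a \<in> carrier R" "d b \<in> carrier R" "d a' \<in> carrier R" "d b' \<in> carrier R"
    using ab a'b' d_closed by (auto simp: fractions_def)
  let ?s = "d a \<otimes> b'" and ?t = "a \<otimes> d b'" and ?v = "d a' \<otimes> b" and ?w = "a' \<otimes> d b"
  have st: "?s \<oplus> ?t = ?v \<oplus> ?w"
    using arg_cong[OF e, of d] car by (simp add: Leibniz)
  have "(d a' \<otimes> b' \<ominus> a' \<otimes> d b') \<otimes> (b \<otimes> b) = ?v \<otimes> (b \<otimes> b') \<ominus> (a' \<otimes> b) \<otimes> (d b' \<otimes> b)"
    using car by (simp add: minus_eq m_ac l_distr r_distr l_minus r_minus)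
  also have "\<dots> = (?v \<ominus> ?t) \<otimes> (b \<otimes> b')"
    unfolding e[symmetric] using car by (simp add: minus_eq m_ac l_distr r_distr l_minus r_minus)
  also have "?v \<ominus> ?t = ?s \<ominus> ?w"
  proof -
    have "?v \<ominus> ?t = (?v \<oplus> ?w) \<ominus> ?t \<ominus> ?w"
      using car by algebra
    also have "\<dots> = ?s \<ominus> ?w"
      unfolding st[symmetric] using car by (simp add: minus_eq a_assoc r_neg)
    finally show ?thesis .
  qed
  also have "(?s \<ominus> ?w) \<otimes> (b \<otimes> b') = d a \<otimes> b \<otimes> (b' \<otimes> b') \<ominus> (a' \<otimes> b) \<otimes> (d b \<otimes> b')"
    using car by (simp add: minus_eq m_ac l_distr r_distr l_minus r_minus)
  also have "\<dots> = (d a \<otimes> b \<ominus> a \<otimes> d b) \<otimes> (b' \<otimes> b')"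
    unfolding e[symmetric] using car by (simp add: minus_eq m_ac l_distr r_distr l_minus r_minus)
  finally show "fraction R ((d a' \<otimes> b') \<ominus> (a' \<otimes> d b')) (b' \<otimes> b') =
      fraction R ((d a \<otimes> b) \<ominus> (a \<otimes> d b)) (b \<otimes> b)"
    using ab a'b' car
    by (subst fraction_eq_iff) (auto simp: fractions_def integral_iff)
qed

lemma frac_deriv_eq_zero_iff:
  assumes d_closed: "\<And>x. x \<in> carrier R \<Longrightarrow> d x \<in> carrier R"
    and Leibniz: "\<And>x y. \<lbrakk>x \<in> carrier R; y \<in> carrier R\<rbrakk> \<Longrightarrow>
      d (x \<otimes> y) = d x \<otimes> y \<oplus> x \<otimes> d y"
    and ab: "(a, b) \<in> fractions R"
  shows "frac_deriv R d (fraction R a b) = \<zero>\<^bsub>frac_field R\<^esub> \<longleftrightarrow> d a \<otimes> b = a \<otimes> d b"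
proof -
  have "(d a \<otimes> b \<ominus> a \<otimes> d b, b \<otimes> b) \<in> fractions R"
    using ab d_closed by (auto simp: fractions_def integral_iff)
  then show ?thesis
    using assms by (simp add: frac_deriv_fraction fraction_eq_zero_iff fractions_def)
qed

end

text \<open>
  The map of fraction fields inherits injectivity from \<open>h\<close>, and its values are constants because
  \<open>d\<close> vanishes on the image of \<open>h\<close>. Hence only surjectivity has content. It is reduced to the
  last hypothesis, which does not mention fraction fields: a fraction \<open>a / b\<close> with
  \<open>d a b = a d b\<close> has a numerator and a denominator coming from \<open>S\<close>.
\<close>

theorem frac_map_iso_constants:
  fixes S (structure) and T :: "('c, 'm) ring_scheme"
  assumes "domain S" and "domain T" and h: "h \<in> ring_hom S T" and inj: "inj_on h (carrier S)"
    and d_closed: "\<And>x. x \<in> carrier T \<Longrightarrow> d x \<in> carrier T"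
    and Leibniz: "\<And>x y. \<lbrakk>x \<in> carrier T; y \<in> carrier T\<rbrakk> \<Longrightarrow>
      d (x \<otimes>\<^bsub>T\<^esub> y) = d x \<otimes>\<^bsub>T\<^esub> y \<oplus>\<^bsub>T\<^esub> x \<otimes>\<^bsub>T\<^esub> d y"
    and d_image: "\<And>x. x \<in> carrier S \<Longrightarrow> d (h x) = \<zero>\<^bsub>T\<^esub>"
    and constant_fraction: "\<And>a b. \<lbrakk>a \<in> carrier T; b \<in> carrier T; b \<noteq> \<zero>\<^bsub>T\<^esub>;
      d a \<otimes>\<^bsub>T\<^esub> b = a \<otimes>\<^bsub>T\<^esub> d b\<rbrakk> \<Longrightarrow>
      \<exists>a'\<in>carrier S. \<exists>b'\<in>carrier S. b' \<noteq> \<zero> \<and> a \<otimes>\<^bsub>T\<^esub> h b' = h a' \<otimes>\<^bsub>T\<^esub> b"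
  shows "frac_map T h \<in> ring_iso (frac_field S)
    (frac_field T\<lparr>carrier :=
      {x \<in> carrier (frac_field T). frac_deriv T d x = \<zero>\<^bsub>frac_field T\<^esub>}\<rparr>)"
proof -
  interpret S: domain S by fact
  interpret T: domain T by fact
  interpret h: ring_hom_cring S T h
    using h by unfold_locales
  have h_frac: "(h a, h b) \<in> fractions T" if "(a, b) \<in> fractions S" for a b
    using that inj inj_on_eq_iff[OF inj, of b \<zero>] by (auto simp: fractions_def)
  have map_fraction: "frac_map T h (fraction S a b) = fraction T (h a) (h b)"
    if ab: "(a, b) \<in> fractions S" for a b
    unfolding frac_map_def
  proof (rule S.UN_fraction[OF ab])
    fix c e
    assume ce: "(c, e) \<in> fractions S" and eq: "a \<otimes> e = c \<otimes> b"
    have "h a \<otimes>\<^bsub>T\<^esub> h e = h c \<otimes>\<^bsub>T\<^esub> h b"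
      using ab ce arg_cong[OF eq, of h] by (simp add: fractions_def)
    then show "fraction T (h c) (h e) = fraction T (h a) (h b)"
      using T.fraction_eq_iff h_frac[OF ab] h_frac[OF ce] by simp
  qed
  have const: "frac_deriv T d (fraction T a b) = \<zero>\<^bsub>frac_field T\<^esub> \<longleftrightarrow>
      d a \<otimes>\<^bsub>T\<^esub> b = a \<otimes>\<^bsub>T\<^esub> d b" if "(a, b) \<in> fractions T" for a b
    using d_closed Leibniz that by (rule T.frac_deriv_eq_zero_iff)
  show ?thesis (is "_ \<in> ring_iso _ ?C")
  proof (rule ring_iso_memI)
    have "frac_map T h x \<in> carrier ?C" if x: "x \<in> carrier (frac_field S)" for x
    proof -
      obtain a b where ab: "(a, b) \<in> fractions S" "x = fraction S a b"
        using x by (rule S.frac_field_carrierE)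
      then have "h a \<in> carrier T" "h b \<in> carrier T" "d (h a) = \<zero>\<^bsub>T\<^esub>" "d (h b) = \<zero>\<^bsub>T\<^esub>"
        using d_image by (auto simp: fractions_def)
      then show ?thesis
        using ab h_frac const by (simp add: map_fraction T.fraction_in_carrier)
    qed
    moreover have "inj_on (frac_map T h) (carrier (frac_field S))"
    proof (rule inj_onI)
      fix x y
      assume "x \<in> carrier (frac_field S)" "y \<in> carrier (frac_field S)"
        and eq: "frac_map T h x = frac_map T h y"
      then obtain a b c e where ab: "(a, b) \<in> fractions S" "x = fraction S a b"
        and ce: "(c, e) \<in> fractions S" "y = fraction S c e"
        by (metis S.frac_field_carrierE)
      have "h a \<otimes>\<^bsub>T\<^esub> h e = h c \<otimes>\<^bsub>T\<^esub> h b"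
        using eq ab ce h_frac by (simp add: map_fraction T.fraction_eq_iff)
      then have "h (a \<otimes> e) = h (c \<otimes> b)"
        using ab ce by (simp add: fractions_def)
      then have "a \<otimes> e = c \<otimes> b"
        using ab ce by (intro inj_onD[OF inj]) (auto simp: fractions_def)
      then show "x = y"
        using ab ce by (simp add: S.fraction_eq_iff)
    qed
    moreover have "x \<in> frac_map T h ` carrier (frac_field S)" if "x \<in> carrier ?C" for x
    proof -
      obtain a b where ab: "(a, b) \<in> fractions T" "x = fraction T a b"
        using \<open>x \<in> carrier ?C\<close> T.frac_field_carrierE[of x] by auto
      then have "d a \<otimes>\<^bsub>T\<^esub> b = a \<otimes>\<^bsub>T\<^esub> d b"
        using \<open>x \<in> carrier ?C\<close> const by simp
      then obtain a' b' where "a' \<in> carrier S" "b' \<in> carrier S" "b' \<noteq> \<zero>"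
        and eq: "a \<otimes>\<^bsub>T\<^esub> h b' = h a' \<otimes>\<^bsub>T\<^esub> b"
        using ab constant_fraction[of a b] by (auto simp: fractions_def)
      then have f: "(a', b') \<in> fractions S"
        by (simp add: fractions_def)
      then have "frac_map T h (fraction S a' b') = x"
        using eq ab h_frac[OF f] by (simp add: map_fraction T.fraction_eq_iff)
      then show ?thesis
        using S.fraction_in_carrier[OF f] by blast
    qed
    ultimately show "bij_betw (frac_map T h) (carrier (frac_field S)) (carrier ?C)"
      unfolding bij_betw_def by blast
    show "\<And>x. x \<in> carrier (frac_field S) \<Longrightarrow> frac_map T h x \<in> carrier ?C" by fact
  next
    fix x y
    assume "x \<in> carrier (frac_field S)" "y \<in> carrier (frac_field S)"
    then obtain a b c e where ab: "(a, b) \<in> fractions S" "x = fraction S a b"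
      and ce: "(c, e) \<in> fractions S" "y = fraction S c e"
      by (metis S.frac_field_carrierE)
    have car: "a \<in> carrier S" "b \<in> carrier S" "c \<in> carrier S" "e \<in> carrier S"
      using ab ce by (auto simp: fractions_def)
    show "frac_map T h (x \<otimes>\<^bsub>frac_field S\<^esub> y) = frac_map T h x \<otimes>\<^bsub>?C\<^esub> frac_map T h y"
      using ab ce car h_frac S.fractions_mult[OF ab(1) ce(1)]
      by (simp add: map_fraction S.frac_field_mult T.frac_field_mult)
    show "frac_map T h (x \<oplus>\<^bsub>frac_field S\<^esub> y) = frac_map T h x \<oplus>\<^bsub>?C\<^esub> frac_map T h y"
      using ab ce car h_frac S.fractions_mult[OF ab(1) ce(1)]
      by (simp add: map_fraction S.frac_field_add T.frac_field_add)
  next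
    have "(\<one>, \<one>) \<in> fractions S"
      by (simp add: fractions_def)
    then show "frac_map T h \<one>\<^bsub>frac_field S\<^esub> = \<one>\<^bsub>?C\<^esub>"
      by (simp add: frac_field_def map_fraction)
  qed
qed

section \<open>Quotients by a principal ideal\<close>

lemma cring_ring_on_UNIV: "cring (ring_on (UNIV :: 'b::comm_ring_1 set))"
  by (rule cringI[OF abelian_groupI comm_monoidI])
    (auto simp: ring_on_def algebra_simps intro: exI[of _ "- x" for x])

lemma subring_ring_on_iff:
  "subring B (ring_on (UNIV :: 'b::comm_ring_1 set)) \<longleftrightarrow>
    1 \<in> B \<and> (\<forall>x\<in>B. - x \<in> B) \<and> (\<forall>x\<in>B. \<forall>y\<in>B. x + y \<in> B \<and> x * y \<in> B)"
proof -
  interpret U: cring "ring_on (UNIV :: 'b set)" by (rule cring_ring_on_UNIV)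
  have neg: "\<ominus>\<^bsub>ring_on UNIV\<^esub> x = - x" for x :: 'b
    by (rule U.minus_equality) (auto simp: ring_on_def)
  show ?thesis
  proof
    assume B: "subring B (ring_on UNIV)"
    show "1 \<in> B \<and> (\<forall>x\<in>B. - x \<in> B) \<and> (\<forall>x\<in>B. \<forall>y\<in>B. x + y \<in> B \<and> x * y \<in> B)"
      using subringE(3)[OF B] subringE(5)[OF B, unfolded neg] subringE(6)[OF B] subringE(7)[OF B]
      by (simp add: ring_on_def)
  next
    assume B: "1 \<in> B \<and> (\<forall>x\<in>B. - x \<in> B) \<and> (\<forall>x\<in>B. \<forall>y\<in>B. x + y \<in> B \<and> x * y \<in> B)"
    show "subring B (ring_on UNIV)"
      by (rule U.subringI, unfold neg) (use B in \<open>simp_all add: ring_on_def\<close>)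
  qed
qed

lemma cring_ring_on:
  assumes "subring B (ring_on (UNIV :: 'b::comm_ring_1 set))"
  shows "cring (ring_on B)"
proof -
  interpret U: cring "ring_on (UNIV :: 'b set)" by (rule cring_ring_on_UNIV)
  have "cring (ring_on UNIV\<lparr>carrier := B\<rparr>)"
    using U.subcring_iff U.subcringI' assms subringE(1) by blast
  then show ?thesis by (simp add: ring_on_def)
qed

text \<open>
  Quotients of a ring of elements of an integral domain by a principal ideal. Primality of \<open>f\<close>
  and the divisibilities below refer to the ambient domain; \<open>saturated\<close> says that the ideal
  generated by \<open>f\<close> in \<open>B\<close> is the trace on \<open>B\<close> of the ambient one. Therefore cosets over
  different rings \<open>B\<close> are compared by one and the same divisibility relation.
\<close>

locale principal_quotient =
  fixes B :: "'b::idom set" and f :: 'b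
  assumes subring: "subring B (ring_on UNIV)"
    and mem: "f \<in> B"
    and saturated: "f * y \<in> B \<Longrightarrow> y \<in> B"
    and prime: "prime_elem f"
begin

abbreviation quot :: "'b set ring" where
  "quot \<equiv> ring_on B Quot (PIdl\<^bsub>ring_on B\<^esub> f)"

abbreviation coset :: "'b \<Rightarrow> 'b set" where
  "coset x \<equiv> (PIdl\<^bsub>ring_on B\<^esub> f) +>\<^bsub>ring_on B\<^esub> x"

sublocale base: cring "ring_on B"
  using subring by (rule cring_ring_on)

lemma closed:
  "0 \<in> B" "1 \<in> B" "x \<in> B \<Longrightarrow> - x \<in> B" "\<lbrakk>x \<in> B; y \<in> B\<rbrakk> \<Longrightarrow> x + y \<in> B"
  "\<lbrakk>x \<in> B; y \<in> B\<rbrakk> \<Longrightarrow> x - y \<in> B" "\<lbrakk>x \<in> B; y \<in> B\<rbrakk> \<Longrightarrow> x * y \<in> B"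
proof -
  show *: "1 \<in> B" "x \<in> B \<Longrightarrow> - x \<in> B" "\<lbrakk>x \<in> B; y \<in> B\<rbrakk> \<Longrightarrow> x + y \<in> B"
    "\<lbrakk>x \<in> B; y \<in> B\<rbrakk> \<Longrightarrow> x * y \<in> B" for x y
    using subring by (auto simp: subring_ring_on_iff)
  show "0 \<in> B"
    using base.zero_closed by (simp add: ring_on_def)
  show "\<lbrakk>x \<in> B; y \<in> B\<rbrakk> \<Longrightarrow> x - y \<in> B"
    using *(2)[of y] *(3)[of x "- y"] by simp
qed

lemma ideal_eq: "PIdl\<^bsub>ring_on B\<^esub> f = {x \<in> B. f dvd x}"
proof -
  have "PIdl\<^bsub>ring_on B\<^esub> f = {f * y | y. y \<in> B}"
    by (auto simp: cgenideal_def ring_on_def mult.commute)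
  also have "\<dots> = {x \<in> B. f dvd x}"
    using closed(6)[OF mem] by (auto elim!: dvdE dest: saturated)
  finally show ?thesis .
qed

sublocale ideal "PIdl\<^bsub>ring_on B\<^esub> f" "ring_on B"
  using mem by (intro base.cgenideal_ideal) (simp add: ring_on_def)

sublocale quot: cring quot
  using base.is_cring by (rule quotient_is_cring)

lemma coset_eq:
  assumes "x \<in> B"
  shows "coset x = {y \<in> B. f dvd y - x}"
proof -
  have "coset x = {j + x | j. j \<in> B \<and> f dvd j}"
    by (auto simp: a_r_coset_def' ideal_eq) (auto simp: ring_on_def)
  also have "\<dots> = {y \<in> B. f dvd y - x}"
    using assms closed(4,5) by (auto intro!: exI[of _ "y - x" for y])
  finally show ?thesis .
qed

lemma coset_eq_iff:
  assumes "x \<in> B" "y \<in> B"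
  shows "coset x = coset y \<longleftrightarrow> f dvd x - y"
proof
  assume "coset x = coset y"
  moreover have "x \<in> coset x"
    using assms by (simp add: coset_eq)
  ultimately show "f dvd x - y"
    using assms by (simp add: coset_eq)
next
  assume xy: "f dvd x - y"
  have "f dvd z - x \<longleftrightarrow> f dvd z - y" for z
    using dvd_add_right_iff[OF xy, of "z - x"] by simp
  then show "coset x = coset y"
    using assms by (simp add: coset_eq)
qed

lemma carrier_quot: "carrier quot = coset ` B"
  by (auto simp: FactRing_def A_RCOSETS_def' ring_on_def)

lemma coset_mult: "\<lbrakk>x \<in> B; y \<in> B\<rbrakk> \<Longrightarrow> coset x \<otimes>\<^bsub>quot\<^esub> coset y = coset (x * y)"
  using rcoset_mult_add[of x y] by (simp add: FactRing_def ring_on_def)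

lemma coset_add: "\<lbrakk>x \<in> B; y \<in> B\<rbrakk> \<Longrightarrow> coset x \<oplus>\<^bsub>quot\<^esub> coset y = coset (x + y)"
  using a_rcos_sum[of x y] by (simp add: FactRing_def ring_on_def)

lemma coset_one: "\<one>\<^bsub>quot\<^esub> = coset 1"
  by (simp add: FactRing_def ring_on_def)

lemma coset_zero: "\<zero>\<^bsub>quot\<^esub> = coset 0"
  using ideal_eq coset_eq[OF closed(1)] by (simp add: FactRing_def)

lemma coset_eq_zero_iff: "x \<in> B \<Longrightarrow> coset x = \<zero>\<^bsub>quot\<^esub> \<longleftrightarrow> f dvd x"
  using coset_eq_iff[of x 0] closed by (simp add: coset_zero)

lemma domain_quot: "domain quot"
proof (rule domainI[OF quot.is_cring])
  show "\<one>\<^bsub>quot\<^esub> \<noteq> \<zero>\<^bsub>quot\<^esub>"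
    using prime closed coset_eq_zero_iff[of 1] by (auto simp: coset_one prime_elem_def)
next
  fix a b
  assume "a \<otimes>\<^bsub>quot\<^esub> b = \<zero>\<^bsub>quot\<^esub>" "a \<in> carrier quot" "b \<in> carrier quot"
  then obtain x y where "x \<in> B" "y \<in> B" "a = coset x" "b = coset y" "f dvd x * y"
    by (auto simp: carrier_quot coset_mult coset_eq_zero_iff closed)
  then show "a = \<zero>\<^bsub>quot\<^esub> \<or> b = \<zero>\<^bsub>quot\<^esub>"
    using prime by (simp add: coset_eq_zero_iff prime_elem_dvd_mult_iff)
qed

end

lemma coset_map_coset:
  assumes "principal_quotient B f" and "principal_quotient Y f"
    and g: "\<And>x. x \<in> B \<Longrightarrow> g x \<in> Y"
    and compat: "\<And>x y. \<lbrakk>x \<in> B; y \<in> B; f dvd x - y\<rbrakk> \<Longrightarrow> f dvd g x - g y"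
    and "x \<in> B"
  shows "coset_map (ring_on Y) (PIdl\<^bsub>ring_on Y\<^esub> f) g (PIdl\<^bsub>ring_on B\<^esub> f +>\<^bsub>ring_on B\<^esub> x) =
    PIdl\<^bsub>ring_on Y\<^esub> f +>\<^bsub>ring_on Y\<^esub> g x"
proof -
  interpret B: principal_quotient B f by fact
  interpret Y: principal_quotient Y f by fact
  show ?thesis
    unfolding coset_map_def
  proof (rule UN_constant_eq)
    show "x \<in> B.coset x"
      using \<open>x \<in> B\<close> by (simp add: B.coset_eq)
    show "\<forall>y\<in>B.coset x. Y.coset (g y) = Y.coset (g x)"
      using \<open>x \<in> B\<close> by (simp add: B.coset_eq Y.coset_eq_iff g compat)
  qed
qed

definition derivation :: "('b::comm_ring_1 \<Rightarrow> 'b) \<Rightarrow> bool" where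
  "derivation d \<longleftrightarrow> (\<forall>x y. d (x + y) = d x + d y) \<and> (\<forall>x y. d (x * y) = d x * y + x * d y)"

lemma derivationD:
  assumes "derivation d"
  shows "d (x + y) = d x + d y" "d (x * y) = d x * y + x * d y"
    "d 0 = 0" "d 1 = 0" "d (- x) = - d x" "d (x - y) = d x - d y"
proof -
  show a: "d (x + y) = d x + d y" "d (x * y) = d x * y + x * d y" for x y
    using assms by (auto simp: derivation_def)
  show z: "d 0 = 0"
    using a(1)[of 0 0] by simp
  show "d 1 = 0"
    using a(2)[of 1 1] by simp
  show m: "d (- x) = - d x" for x
    using a(1)[of x "- x"] z by (simp add: eq_neg_iff_add_eq_0 add.commute)
  show "d (x - y) = d x - d y"
    using a(1)[of x "- y"] m[of y] by simp
qed

text \<open>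
  The isomorphism onto the constants for the quotients of \<open>B \<subseteq> Y\<close> by the same \<open>f\<close>, with every
  condition expressed by divisibility in the ambient domain. Injectivity of the map of
  quotients is the fact that equality of cosets is divisibility by \<open>f\<close> on both sides.
\<close>

theorem quotient_constants_iso:
  assumes B: "principal_quotient B f" and Y: "principal_quotient Y f" and "B \<subseteq> Y"
    and d: "derivation d" and "d f = 0" and d_Y: "d ` Y \<subseteq> Y"
    and d_X: "\<And>x. x \<in> B \<Longrightarrow> d x = 0"
    and constant_fraction: "\<And>a b. \<lbrakk>a \<in> Y; b \<in> Y; \<not> f dvd b; f dvd d a * b - a * d b\<rbrakk> \<Longrightarrow>
      \<exists>a'\<in>B. \<exists>b'\<in>B. \<not> f dvd b' \<and> f dvd a * b' - a' * b"
  defines "S \<equiv> ring_on B Quot (PIdl\<^bsub>ring_on B\<^esub> f)"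
    and "T \<equiv> ring_on Y Quot (PIdl\<^bsub>ring_on Y\<^esub> f)"
    and "h \<equiv> coset_map (ring_on Y) (PIdl\<^bsub>ring_on Y\<^esub> f)"
  shows "frac_map T (h (\<lambda>x. x)) \<in> ring_iso (frac_field S)
    (frac_field T\<lparr>carrier :=
      {x \<in> carrier (frac_field T). frac_deriv T (h d) x = \<zero>\<^bsub>frac_field T\<^esub>}\<rparr>)"
proof -
  interpret B: principal_quotient B f by fact
  interpret Y: principal_quotient Y f by fact
  have Y_mem: "x \<in> Y" if "x \<in> B" for x
    using that \<open>B \<subseteq> Y\<close> by blast
  have d_mem: "d y \<in> Y" if "y \<in> Y" for y
    using that d_Y by blast
  have d_dvd: "f dvd d x - d y" if xy: "f dvd x - y" for x y
  proof -
    obtain q where q: "x - y = f * q"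
      using xy by (rule dvdE)
    have "d x - d y = f * d q"
      using arg_cong[OF q, of d] \<open>d f = 0\<close> by (simp add: derivationD[OF d])
    then show ?thesis by simp
  qed
  have inc: "h (\<lambda>x. x) (B.coset x) = Y.coset x" if "x \<in> B" for x
    unfolding h_def using B Y that Y_mem by (intro coset_map_coset) auto
  have deriv: "h d (Y.coset y) = Y.coset (d y)" if "y \<in> Y" for y
    unfolding h_def using Y that d_mem d_dvd by (intro coset_map_coset) auto
  show ?thesis
  proof (rule frac_map_iso_constants)
    show "domain S" "domain T"
      unfolding S_def T_def by (rule B.domain_quot Y.domain_quot)+
    show "h (\<lambda>x. x) \<in> ring_hom S T"
      unfolding S_def T_def
      by (rule ring_hom_memI)
        (auto simp: B.carrier_quot Y.carrier_quot B.coset_mult B.coset_add B.coset_one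
          Y.coset_mult Y.coset_add Y.coset_one inc B.closed Y_mem)
    show "inj_on (h (\<lambda>x. x)) (carrier S)"
    proof (rule inj_onI)
      fix x y
      assume "x \<in> carrier S" "y \<in> carrier S" and eq: "h (\<lambda>x. x) x = h (\<lambda>x. x) y"
      then obtain a b where "a \<in> B" "b \<in> B" "x = B.coset a" "y = B.coset b"
        by (auto simp: S_def B.carrier_quot)
      then show "x = y"
        using eq by (simp add: inc B.coset_eq_iff Y.coset_eq_iff Y_mem)
    qed
    show "h d x \<in> carrier T" if "x \<in> carrier T" for x
      using that unfolding T_def by (auto simp: Y.carrier_quot deriv d_mem)
    show "h d (x \<otimes>\<^bsub>T\<^esub> y) = h d x \<otimes>\<^bsub>T\<^esub> y \<oplus>\<^bsub>T\<^esub> x \<otimes>\<^bsub>T\<^esub> h d y"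
      if "x \<in> carrier T" "y \<in> carrier T" for x y
      using that unfolding T_def
      by (auto simp: Y.carrier_quot Y.coset_mult Y.coset_add deriv d_mem Y.closed derivationD[OF d])
    show "h d (h (\<lambda>x. x) x) = \<zero>\<^bsub>T\<^esub>" if "x \<in> carrier S" for x
      using that unfolding S_def T_def
      by (auto simp: B.carrier_quot inc deriv Y_mem d_X Y.coset_zero)
    fix x y
    assume "x \<in> carrier T" "y \<in> carrier T" and y: "y \<noteq> \<zero>\<^bsub>T\<^esub>"
      and eq: "h d x \<otimes>\<^bsub>T\<^esub> y = x \<otimes>\<^bsub>T\<^esub> h d y"
    then obtain a b where ab: "a \<in> Y" "b \<in> Y" and xy: "x = Y.coset a" "y = Y.coset b"
      by (auto simp: T_def Y.carrier_quot)
    have "\<not> f dvd b"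
      using ab y by (simp add: xy T_def Y.coset_eq_zero_iff)
    moreover have "f dvd d a * b - a * d b"
      using ab eq by (simp add: xy T_def deriv Y.coset_mult Y.coset_eq_iff d_mem Y.closed)
    ultimately obtain a' b' where a'b': "a' \<in> B" "b' \<in> B" "\<not> f dvd b'" "f dvd a * b' - a' * b"
      using constant_fraction ab by blast
    then have "x \<otimes>\<^bsub>T\<^esub> h (\<lambda>x. x) (B.coset b') = h (\<lambda>x. x) (B.coset a') \<otimes>\<^bsub>T\<^esub> y"
      using ab by (simp add: xy T_def inc Y.coset_mult Y.coset_eq_iff Y_mem Y.closed)
    moreover have "B.coset a' \<in> carrier S" "B.coset b' \<in> carrier S" "B.coset b' \<noteq> \<zero>\<^bsub>S\<^esub>"
      using a'b' by (simp_all add: S_def B.carrier_quot B.coset_eq_zero_iff)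
    ultimately show "\<exists>a'\<in>carrier S. \<exists>b'\<in>carrier S. b' \<noteq> \<zero>\<^bsub>S\<^esub> \<and>
        x \<otimes>\<^bsub>T\<^esub> h (\<lambda>x. x) b' = h (\<lambda>x. x) a' \<otimes>\<^bsub>T\<^esub> y"
      by blast
  qed
qed

section \<open>Polynomials over a differential field\<close>

lemma mem_polys_over_iff:
  assumes "0 \<in> S"
  shows "p \<in> polys_over S \<longleftrightarrow> (\<forall>n. Polynomial.coeff p n \<in> S)"
proof -
  have "range (Polynomial.coeff p) \<subseteq> S \<longleftrightarrow> set (coeffs p) \<subseteq> S"
    unfolding range_coeff using assms by simp
  then show ?thesis
    by (auto simp: polys_over_def)
qed

lemma linear_mem_polys_over:
  "\<lbrakk>0 \<in> S; a \<in> S; b \<in> S\<rbrakk> \<Longrightarrow> [:a, b:] \<in> polys_over S"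
  by (simp add: mem_polys_over_iff coeff_pCons split: nat.split)

lemma subring_zero:
  assumes "subring F (ring_on (UNIV :: 'b::comm_ring_1 set))"
  shows "0 \<in> F"
  using subringE(2)[OF assms] by (simp add: ring_on_def)

lemma subring_sum:
  assumes F: "subring F (ring_on (UNIV :: 'b::comm_ring_1 set))"
    and "\<And>i. i \<in> I \<Longrightarrow> g i \<in> F"
  shows "sum g I \<in> F"
  using assms(2)
proof (induction I rule: infinite_finite_induct)
  case (insert i I)
  then show ?case using F by (simp add: subring_ring_on_iff)
qed (simp_all add: subring_zero[OF F])

lemma subring_polys_over:
  assumes F: "subring F (ring_on (UNIV :: 'b::comm_ring_1 set))"
  shows "subring (polys_over F) (ring_on UNIV)"
proof -
  note F0 = subring_zero[OF F]
  have cl: "1 \<in> F" "\<And>x. x \<in> F \<Longrightarrow> - x \<in> F" "\<And>x y. \<lbrakk>x \<in> F; y \<in> F\<rbrakk> \<Longrightarrow> x + y \<in> F"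
    "\<And>x y. \<lbrakk>x \<in> F; y \<in> F\<rbrakk> \<Longrightarrow> x * y \<in> F"
    using F by (auto simp: subring_ring_on_iff)
  have "Polynomial.coeff (p * q) n \<in> F"
    if "\<forall>n. Polynomial.coeff p n \<in> F" "\<forall>n. Polynomial.coeff q n \<in> F" for p q n
    unfolding coeff_mult using that cl(4) by (intro subring_sum[OF F]) blast
  then show ?thesis
    using cl F0 by (simp add: subring_ring_on_iff mem_polys_over_iff coeff_1)
qed

lemma derivation_map_poly:
  assumes "derivation d"
  shows "derivation (map_poly d)"
proof -
  note d = derivationD[OF assms]
  have d_sum: "d (sum g I) = (\<Sum>i\<in>I. d (g i))" for g :: "nat \<Rightarrow> 'a" and I
    by (induction I rule: infinite_finite_induct) (simp_all add: d)
  show ?thesis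
    unfolding derivation_def
    by (intro conjI allI; rule poly_eqI)
      (simp_all add: coeff_map_poly coeff_mult d d_sum sum.distrib)
qed

lemma map_poly_derivation_eq_zero_iff:
  assumes "derivation d"
  shows "map_poly d p = 0 \<longleftrightarrow> p \<in> polys_over (constants d)"
  using derivationD(3)[OF assms]
  by (simp add: poly_eq_iff coeff_map_poly mem_polys_over_iff constants_def)

lemma derivation_constants_map_poly:
  "derivation d \<Longrightarrow> constants (map_poly d) = polys_over (constants d)"
  unfolding constants_def[of "map_poly d"] by (simp add: map_poly_derivation_eq_zero_iff)

lemma subring_constants:
  "derivation d \<Longrightarrow> subring (constants d) (ring_on UNIV)"
  by (auto simp: subring_ring_on_iff constants_def derivationD)

text \<open>
  The field of constants of the rational functions in one variable over a differential field
  consists of the rational functions with constant coefficients. Among all denominators of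
  \<open>p / q\<close> take a monic one \<open>q0\<close> of least degree. A constant fraction satisfies
  \<open>p0 / q0 = D p0 / D q0\<close> whenever \<open>D q0 \<noteq> 0\<close>, and \<open>D q0\<close> has smaller degree than \<open>q0\<close> because
  the leading coefficient 1 is killed; so \<open>D q0 = 0\<close>, and then \<open>D p0 = 0\<close>.
\<close>

lemma constant_rational_function:
  fixes d :: "'a::field \<Rightarrow> 'a" and p q :: "'a poly"
  assumes "derivation d" and "q \<noteq> 0" and eq: "map_poly d p * q = p * map_poly d q"
  obtains p0 q0 where "p0 \<in> polys_over (constants d)" "q0 \<in> polys_over (constants d)"
    "q0 \<noteq> 0" "p * q0 = p0 * q"
proof -
  let ?D = "map_poly d"
  note d = derivationD[OF assms(1)] and D = derivationD[OF derivation_map_poly[OF assms(1)]]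
  define represents where "represents = (\<lambda>(p', q'). q' \<noteq> 0 \<and> p * q' = p' * q)"
  obtain p1 q1 where "represents (p1, q1)"
    and least: "\<And>p' q'. represents (p', q') \<Longrightarrow> Polynomial.degree q1 \<le> Polynomial.degree q'"
    using \<open>q \<noteq> 0\<close> ex_has_least_nat[of represents "(p, q)" "\<lambda>r. Polynomial.degree (snd r)"]
    by (force simp: represents_def)
  define c where "c = inverse (Polynomial.lead_coeff q1)"
  define p0 q0 where "p0 = Polynomial.smult c p1" and "q0 = Polynomial.smult c q1"
  have "c \<noteq> 0" "q1 \<noteq> 0"
    using \<open>represents (p1, q1)\<close> by (auto simp: c_def represents_def)
  then have monic: "Polynomial.lead_coeff q0 = 1"
    and q0: "q0 \<noteq> 0" "p * q0 = p0 * q" "Polynomial.degree q0 = Polynomial.degree q1"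
    using \<open>represents (p1, q1)\<close> by (auto simp: p0_def q0_def c_def represents_def)
  have "q * (p * ?D q0) = q * (?D p0 * q)"
  proof -
    have "?D p * q0 + p * ?D q0 = ?D p0 * q + p0 * ?D q"
      using arg_cong[OF q0(2), of ?D] by (simp add: D)
    then have "q * (?D p * q0 + p * ?D q0) = q * (?D p0 * q + p0 * ?D q)"
      by (simp only:)
    then have "q * (p * ?D q0) = q * (?D p0 * q) + (p0 * q) * ?D q - (?D p * q) * q0"
      by (simp add: algebra_simps)
    then show ?thesis
      unfolding eq q0(2)[symmetric] by (simp add: algebra_simps)
  qed
  then have D_quotient: "p * ?D q0 = ?D p0 * q"
    using \<open>q \<noteq> 0\<close> by simp
  have "?D q0 = 0"
  proof (rule ccontr)
    assume "?D q0 \<noteq> 0"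
    then have "Polynomial.degree q0 \<le> Polynomial.degree (?D q0)"
      using least[of "?D p0" "?D q0"] D_quotient q0(3) by (simp add: represents_def)
    moreover have "Polynomial.coeff (?D q0) (Polynomial.degree q0) = 0"
      using monic by (simp add: coeff_map_poly d)
    moreover have "Polynomial.degree (?D q0) \<le> Polynomial.degree q0"
      by (rule degree_le) (simp add: coeff_map_poly d coeff_eq_0)
    ultimately show False
      using \<open>?D q0 \<noteq> 0\<close> leading_coeff_0_iff[of "?D q0"] by (metis le_antisym)
  qed
  moreover from this have "?D p0 = 0"
    using D_quotient \<open>q \<noteq> 0\<close> by simp
  ultimately show thesis
    using that q0 by (simp add: map_poly_derivation_eq_zero_iff[OF assms(1)])
qed

section \<open>The curve polynomial\<close>

lemma curve_poly_mult: "curve_poly R * q = Polynomial.smult R q + pCons 0 (pCons 0 q)"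
  by (simp add: curve_poly_def)

text \<open>
  As the curve polynomial is monic in \<open>\<mu>\<close>, the coefficients of a cofactor are obtained from those of
  the product by descending recursion, using only ring operations.
\<close>

lemma curve_poly_saturated:
  fixes F :: "'b::comm_ring_1 poly set"
  assumes F: "subring F (ring_on UNIV)" and "R \<in> F" and "curve_poly R * q \<in> polys_over F"
  shows "q \<in> polys_over F"
proof -
  note F0 = subring_zero[OF F]
  have "Polynomial.coeff q n \<in> F" for n
  proof (induction "Suc (Polynomial.degree q) - n" arbitrary: n rule: less_induct)
    case less
    show ?case
    proof (cases "n \<le> Polynomial.degree q")
      case False
      then show ?thesis using F0 by (simp add: coeff_eq_0)
    next
      case True
      then have "Polynomial.coeff q (n + 2) \<in> F"
        by (intro less) simp
      then have *: "- (R * Polynomial.coeff q (n + 2)) \<in> F"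
        using F \<open>R \<in> F\<close> by (simp add: subring_ring_on_iff)
      have "Polynomial.coeff (curve_poly R * q) (n + 2) \<in> F"
        using assms(3) F0 by (simp add: mem_polys_over_iff)
      with * have "Polynomial.coeff (curve_poly R * q) (n + 2) +
          - (R * Polynomial.coeff q (n + 2)) \<in> F"
        using F unfolding subring_ring_on_iff by blast
      then show ?thesis
        by (simp add: curve_poly_mult numeral_2_eq_2)
    qed
  qed
  then show ?thesis
    using F0 by (simp add: mem_polys_over_iff)
qed

lemma curve_poly_remainder:
  obtains q a b where "x = curve_poly R * q + [:a, b:]"
proof -
  have "\<exists>q a b. x = curve_poly R * q + [:a, b:]"
  proof (induction x)
    case 0
    show ?case by (rule exI[of _ 0]) auto
  next
    case (pCons c x)
    then obtain q a b where x: "x = curve_poly R * q + [:a, b:]" by blast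
    have "pCons c x = curve_poly R * (pCons b q) + [:c - R * b, a:]"
      unfolding x curve_poly_mult by (simp add: add.assoc)
    then show ?case by blast
  qed
  then show thesis using that by blast
qed

lemma curve_poly_dvd_linear_iff:
  fixes R :: "'b::idom poly"
  shows "curve_poly R dvd [:a, b:] \<longleftrightarrow> a = 0 \<and> b = 0"
proof
  assume dvd: "curve_poly R dvd [:a, b:]"
  have "Polynomial.degree (curve_poly R) = 2"
    by (simp add: curve_poly_def)
  moreover have "Polynomial.degree [:a, b:] \<le> 1"
    using degree_pCons_le[of a "[:b:]"] by simp
  ultimately have "[:a, b:] = 0"
    using dvd dvd_imp_degree_le[OF dvd] by linarith
  then show "a = 0 \<and> b = 0" by simp
qed simp

text \<open>
  The norm of \<open>a + b \<mu>\<close> down to polynomials in \<open>\<lambda>\<close>. It does not vanish because \<open>-R\<close>, having odd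
  degree, is not the square of a rational function.
\<close>

lemma norm_nonzero:
  fixes R :: "'b::idom poly"
  assumes "odd (Polynomial.degree R)" and "a \<noteq> 0 \<or> b \<noteq> 0"
  shows "a * a + R * (b * b) \<noteq> 0"
proof
  assume "a * a + R * (b * b) = 0"
  then have eq: "a * a = - (R * (b * b))"
    by (simp add: eq_neg_iff_add_eq_0)
  have "R \<noteq> 0" using assms(1) by auto
  then have "a \<noteq> 0" "b \<noteq> 0"
    using assms(2) eq by auto
  then have "2 * Polynomial.degree a = Polynomial.degree R + 2 * Polynomial.degree b"
    using arg_cong[OF eq, of Polynomial.degree] \<open>R \<noteq> 0\<close> by (simp add: degree_mult_eq)
  then show False
    using assms(1) by presburger
qed

text \<open>
  Modulo \<open>\<mu>\<^sup>2 + R\<close> every nonzero element divides a nonzero polynomial in \<open>\<lambda>\<close> alone: multiply it by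
  its conjugate under \<open>\<mu> \<mapsto> -\<mu>\<close>. This makes denominators of functions on the curve rational
  in \<open>\<lambda>\<close>.
\<close>

lemma curve_poly_nonzero_norm:
  fixes R :: "'b::idom poly"
  assumes "odd (Polynomial.degree R)" and "\<not> curve_poly R dvd x"
  obtains y k N where "x * y = [:N:] + curve_poly R * k" "N \<noteq> 0"
proof -
  let ?f = "curve_poly R"
  obtain q a b where x: "x = ?f * q + [:a, b:]"
    by (rule curve_poly_remainder)
  then have "a \<noteq> 0 \<or> b \<noteq> 0"
    using assms(2) by auto
  then have N: "a * a + R * (b * b) \<noteq> 0"
    using assms(1) by (intro norm_nonzero)
  have "[:a, b:] * [:a, - b:] = [:a * a + R * (b * b):] + ?f * [:- (b * b):]"
    by (simp add: curve_poly_def)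
  then have "x * [:a, - b:] = [:a * a + R * (b * b):] + ?f * ([:- (b * b):] + q * [:a, - b:])"
    unfolding x by (simp only: distrib_left distrib_right ac_simps)
  with N show thesis using that by blast
qed

text \<open>
  If \<open>y\<close> is not divisible, a multiple of \<open>y\<close> is a nonzero polynomial \<open>N\<close> in \<open>\<lambda>\<close>, and the
  quotient is free over the polynomials in \<open>\<lambda>\<close> with basis \<open>1, \<mu>\<close>; so \<open>N x \<equiv> 0\<close> forces \<open>x \<equiv> 0\<close>.
\<close>

lemma prime_curve_poly:
  fixes R :: "'b::idom poly"
  assumes odd: "odd (Polynomial.degree R)"
  shows "prime_elem (curve_poly R)"
proof (rule prime_elemI)
  let ?f = "curve_poly R"
  show "?f \<noteq> 0"
    by (simp add: curve_poly_def)
  show "\<not> ?f dvd 1"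
    using curve_poly_dvd_linear_iff[of R 1 0] by (simp add: one_pCons)
  fix x y
  assume dvd: "?f dvd x * y"
  show "?f dvd x \<or> ?f dvd y"
  proof (rule disjCI)
    assume "\<not> ?f dvd y"
    then obtain z k N where N: "y * z = [:N:] + ?f * k" "N \<noteq> 0"
      by (rule curve_poly_nonzero_norm[OF odd])
    obtain q a b where x: "x = ?f * q + [:a, b:]"
      by (rule curve_poly_remainder)
    have "x * y * z = ?f * (q * (y * z) + [:a, b:] * k) + [:a, b:] * [:N:]"
      unfolding x mult.assoc N(1) by (simp only: distrib_left distrib_right ac_simps)
    moreover have "?f dvd x * y * z"
      using dvd by simp
    ultimately have "?f dvd [:a, b:] * [:N:]"
      using dvd_add_right_iff[of ?f] by (metis dvd_triv_left)
    then have "?f dvd [:a * N, b * N:]"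
      by (simp add: mult.commute)
    then show "?f dvd x"
      using \<open>N \<noteq> 0\<close> by (simp add: curve_poly_dvd_linear_iff x)
  qed
qed

text \<open>
  Write \<open>x / y = (a + b \<mu>) / N\<close> with \<open>a\<close>, \<open>b\<close>, \<open>N\<close> in \<open>\<lambda>\<close> alone. As the derivation kills \<open>\<mu>\<close>, and
  \<open>1, \<mu>\<close> is a basis, this is constant exactly if the rational functions \<open>a / N\<close> and \<open>b / N\<close>
  are, which therefore have the form \<open>a0 / p\<close> and \<open>b0 / q\<close> with constant coefficients. The
  desired fraction is their combination over the common denominator \<open>p q\<close>.
\<close>

lemma constant_fraction_curve:
  fixes d :: "'a::field \<Rightarrow> 'a" and R :: "'a poly" and x y :: "'a poly poly"
  defines "D \<equiv> map_poly (map_poly d)" and "f \<equiv> curve_poly R"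
  assumes d: "derivation d" and R: "R \<in> polys_over (constants d)"
    and odd: "odd (Polynomial.degree R)"
    and y: "\<not> f dvd y" and const: "f dvd D x * y - x * D y"
  obtains x' y' where "x' \<in> polys_over (polys_over (constants d))"
    "y' \<in> polys_over (polys_over (constants d))" "\<not> f dvd y'" "f dvd x * y' - x' * y"
proof -
  let ?D = "map_poly d"
  note dD = derivation_map_poly[OF d]
  note P = subring_polys_over[OF subring_constants[OF d]]
  note P0 = subring_zero[OF P]
  note D1 = derivationD[OF dD]
  note D = derivationD[OF derivation_map_poly[OF dD], folded D_def]
  have D_f: "D f = 0"
    using R by (simp add: D_def f_def curve_poly_def map_poly_pCons D1
      map_poly_derivation_eq_zero_iff[OF d])
  have prime: "prime_elem f"
    unfolding f_def using odd by (rule prime_curve_poly)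
  obtain z k N where N: "y * z = [:N:] + f * k" "N \<noteq> 0"
    using y unfolding f_def by (rule curve_poly_nonzero_norm[OF odd])
  obtain l a b where ab: "x * z = f * l + [:a, b:]"
    unfolding f_def by (rule curve_poly_remainder)
  have "f dvd D [:a, b:] * [:N:] - [:a, b:] * D [:N:]"
  proof -
    \<comment> \<open>Being constant does not depend on the representative of a fraction: extending \<open>x / y\<close> by
      \<open>z\<close> multiplies \<open>D x y - x D y\<close> by \<open>z\<^sup>2\<close>.\<close>
    have "(z * z) * (D x * y - x * D y) = D (x * z) * (y * z) - (x * z) * D (y * z)"
      by (simp add: D algebra_simps)
    also have "\<dots> = D [:a, b:] * [:N:] - [:a, b:] * D [:N:] +
        f * (D l * (y * z) + D [:a, b:] * k - l * D (y * z) - [:a, b:] * D k)"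
      unfolding ab N(1) D D_f by (simp only: mult_zero_left add_0_left distrib_left distrib_right
          right_diff_distrib left_diff_distrib) (simp only: algebra_simps)
    finally show ?thesis
      using const by (metis dvd_add_left_iff dvd_mult dvd_triv_left)
  qed
  also have "D [:a, b:] * [:N:] - [:a, b:] * D [:N:] = [:?D a * N - a * ?D N, ?D b * N - b * ?D N:]"
    by (simp add: D_def map_poly_pCons D1 algebra_simps)
  finally have "?D a * N = a * ?D N" "?D b * N = b * ?D N"
    by (simp_all add: f_def curve_poly_dvd_linear_iff)
  then obtain a0 p b0 q
    where a0: "a0 \<in> polys_over (constants d)" "p \<in> polys_over (constants d)" "p \<noteq> 0" "a * p = a0 * N"
      and b0: "b0 \<in> polys_over (constants d)" "q \<in> polys_over (constants d)" "q \<noteq> 0" "b * q = b0 * N"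
    by (metis constant_rational_function[OF d \<open>N \<noteq> 0\<close>])
  let ?x = "[:a0 * q, b0 * p:]" and ?y = "[:p * q:]"
  have "?x \<in> polys_over (polys_over (constants d))" "?y \<in> polys_over (polys_over (constants d))"
    using P a0 b0 linear_mem_polys_over[OF P0, of "a0 * q" "b0 * p"]
      linear_mem_polys_over[OF P0 _ P0, of "p * q"]
    by (simp_all add: subring_ring_on_iff)
  moreover have "\<not> f dvd ?y"
    using a0 b0 curve_poly_dvd_linear_iff[of R "p * q" 0] by (simp add: f_def)
  moreover have "f dvd x * ?y - ?x * y"
  proof -
    \<comment> \<open>The denominators are cleared only after multiplication by \<open>z\<close>, which is cancelled modulo
      the prime \<open>f\<close> afterwards.\<close>
    have "[:a, b:] * ?y = [:(a * p) * q, (b * q) * p:]"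
      by (simp add: ac_simps)
    also have "\<dots> = ?x * [:N:]"
      unfolding a0 b0 by (simp add: ac_simps)
    finally have "z * (x * ?y - ?x * y) = f * (l * ?y - ?x * k)"
      using arg_cong[OF ab, of "\<lambda>t. t * ?y"] arg_cong[OF N(1), of "\<lambda>t. t * ?x"]
      by (simp only: algebra_simps)
    then have "f dvd z * (x * ?y - ?x * y)"
      by simp
    moreover have "\<not> f dvd z"
    proof
      assume "f dvd z"
      then have "f dvd [:N:] + f * k"
        unfolding N(1)[symmetric] by simp
      then have "f dvd [:N, 0:]"
        by (simp add: dvd_add_left_iff)
      then show False
        using \<open>N \<noteq> 0\<close> unfolding f_def curve_poly_dvd_linear_iff by simp
    qed
    ultimately show ?thesis
      using prime by (simp add: prime_elem_dvd_mult_iff)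
  qed
  ultimately show thesis by (rule that)
qed

section \<open>Constants of the function field\<close>

lemma diff_subfield_generated_closed:
  fixes D :: "'a::field \<Rightarrow> 'a"
  shows "subring (diff_subfield_generated D Z) (ring_on UNIV)"
    and "D ` diff_subfield_generated D Z \<subseteq> diff_subfield_generated D Z"
    and "Z \<subseteq> diff_subfield_generated D Z"
proof -
  have "subring F (ring_on UNIV)" if "subfield F (ring_on UNIV)" for F :: "'a set"
    using that by (rule subfieldE(1))
  then show "subring (diff_subfield_generated D Z) (ring_on UNIV)"
    by (simp add: subring_ring_on_iff diff_subfield_generated_def)
qed (auto simp: diff_subfield_generated_def)

lemma principal_quotient_curve_poly:
  fixes R :: "'b::idom poly"
  assumes F: "subring F (ring_on UNIV)" and R: "R \<in> polys_over F" and "odd (Polynomial.degree R)"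
  shows "principal_quotient (polys_over (polys_over F)) (curve_poly R)"
proof (rule principal_quotient.intro)
  note P = subring_polys_over[OF F]
  show "subring (polys_over (polys_over F)) (ring_on UNIV)"
    by (rule subring_polys_over[OF P])
  show "curve_poly R \<in> polys_over (polys_over F)"
    using P R subring_zero[OF P]
    by (auto simp: mem_polys_over_iff curve_poly_def coeff_pCons subring_ring_on_iff split: nat.split)
  show "y \<in> polys_over (polys_over F)" if "curve_poly R * y \<in> polys_over (polys_over F)" for y
    using P R that by (rule curve_poly_saturated)
  show "prime_elem (curve_poly R)"
    using assms(3) by (rule prime_curve_poly)
qed

theorem theoremB:
  fixes D :: "'a::field_char_0 \<Rightarrow> 'a" and u :: 'a and s :: nat and A R :: "'a poly"
    and C K :: "'a set"
  assumes "differential_field D"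
    and "C = constants D"
    and "algebraically_closed (ring_on C)"
    and "u \<notin> C"
    and "algebro_geometric D (schroedinger u)"
    and "is_partner D (schroedinger u) s A R"
    and "K = diff_subfield_generated D (C \<union> {u})"
  shows "base_change K R \<in>
           ring_iso (function_field C R)
             (function_field K R\<lparr>carrier := function_field_constants D K R\<rparr>)"
proof -
  let ?D = "map_poly (map_poly D)" and ?f = "curve_poly R"
  let ?C = "polys_over (polys_over C)" and ?K = "polys_over (polys_over K)"
  have D: "derivation D"
    using assms(1) by (auto simp: derivation_def differential_field_def)
  note D1 = derivation_map_poly[OF D] and D2 = derivation_map_poly[OF derivation_map_poly[OF D]]
  have R: "R \<in> polys_over C" and odd: "odd (Polynomial.degree R)"
    using assms(2,6) by (auto simp: is_partner_def)
  have C: "subring C (ring_on UNIV)"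
    unfolding assms(2) using D by (rule subring_constants)
  have K: "subring K (ring_on UNIV)" "D ` K \<subseteq> K" "C \<subseteq> K"
    unfolding assms(7) using diff_subfield_generated_closed[where D = D and Z = "C \<union> {u}"]
    by auto
  have zero: "0 \<in> C" "0 \<in> K" "0 \<in> polys_over C" "0 \<in> polys_over K"
    using subring_zero C K(1) subring_polys_over by blast+
  have CK: "polys_over C \<subseteq> polys_over K"
    using K(3) by (auto simp: polys_over_def)
  have "frac_map (coord_ring K R) (coset_map (ring_on ?K) (PIdl\<^bsub>ring_on ?K\<^esub> ?f) (\<lambda>x. x)) \<in>
      ring_iso (frac_field (coord_ring C R)) (frac_field (coord_ring K R)
        \<lparr>carrier := {x \<in> carrier (frac_field (coord_ring K R)).
          frac_deriv (coord_ring K R) (coset_map (ring_on ?K) (PIdl\<^bsub>ring_on ?K\<^esub> ?f) ?D) x =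
          \<zero>\<^bsub>frac_field (coord_ring K R)\<^esub>}\<rparr>)"
    unfolding coord_ring_def bipoly_ring_def curve_ideal_def
  proof (rule quotient_constants_iso[OF _ _ _ D2])
    show "principal_quotient ?C ?f"
      using C R odd by (rule principal_quotient_curve_poly)
    show "principal_quotient ?K ?f"
      using K(1) _ odd by (rule principal_quotient_curve_poly) (use R CK in blast)
    show "?C \<subseteq> ?K"
      using CK by (auto simp: polys_over_def[of "polys_over _"])
    show "?D ?f = 0"
      using R by (simp add: curve_poly_def map_poly_pCons derivationD[OF D1] assms(2)
          map_poly_derivation_eq_zero_iff[OF D])
    show "?D ` ?K \<subseteq> ?K"
    proof -
      have "D x \<in> K" if "x \<in> K" for x
        using that K(2) by blast
      then show ?thesis
        using zero
        by (auto simp: mem_polys_over_iff coeff_map_poly derivationD[OF D1] derivationD[OF D])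
    qed
    show "?D x = 0" if "x \<in> ?C" for x
      using that by (simp add: map_poly_derivation_eq_zero_iff[OF D1]
          derivation_constants_map_poly[OF D] assms(2))
    show "\<exists>x'\<in>?C. \<exists>y'\<in>?C. \<not> ?f dvd y' \<and> ?f dvd x * y' - x' * y"
      if "\<not> ?f dvd y" "?f dvd ?D x * y - x * ?D y" for x y
      using constant_fraction_curve[OF D R[unfolded assms(2)] odd that] unfolding assms(2) by blast
  qed
  then show ?thesis
    by (simp add: base_change_def function_field_def function_field_constants_def
        function_field_deriv_def coord_ring_deriv_def curve_ideal_def bipoly_ring_def)
qed

end
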